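(* Let $\mathbb G$ be a finitely generated infinite group which is not virtually $\mathbb Z$ or $\mathbb Z^2$, let $\mu$ be a symmetric, non-degenerate, finitely supported probability measure on $\mathbb G$, and let $\psi$ be a growth gauge. If there exists a non-constant minimal $\mu$-harmonic function whose growth is at least $\psi$ (respectively, at most $\psi$), then there are infinitely many distinct normalised minimal $\mu$-harmonic functions with growth at least $\psi$ (respectively, at most $\psi$).
   Context: Non-degenerate: $\operatorname{supp}\mu$ generates $\mathbb G$ as a semigroup; symmetric: $\mu(g)=\mu(g^{-1})$. $|\cdot|$ is the word length of a fixed finite symmetric generating set. $f$ is $\mu$-harmonic if $f(x)=\sum_g\mu(g)f(xg)$ for all $x$. A positive $\mu$-harmonic function $h:\mathbb G\to(0,\infty)$ is minimal if every positive $\mu$-harmonic $u\le h$ is of the form $u=ch$ with $c>0$. Normalised means taking the value $1$ at the identity $e$. A growth gauge is a non-decreasing function $\psi:\mathbb N\to(0,\infty)$ such that for every $c\in\mathbb N$ there is $K_c\ge1$ with $\psi(r+c)\le K_c\psi(r)$ for all $r\in\mathbb N$. A function $f:\mathbb G\to\mathbb R$ has growth at most $\psi$ (upper growth $\preccurlyeq\psi$) if there is $C>0$ with $|f(x)|\le C\psi(|x|)$ for all $x$ with $|x|$ large; it has growth at least $\psi$ (lower growth $\succcurlyeq\psi$) if there is $C>0$ with $\sup_{|x|\le r}|f(x)|\ge C\psi(r)$ for all large $r$. *)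

theory Defs
  imports "HOL-Algebra.Elementary_Groups" "HOL-Probability.Probability_Mass_Function"
begin

definition virtually :: "('a, 'm) monoid_scheme \<Rightarrow> ('b, 'n) monoid_scheme \<Rightarrow> bool" where
  "virtually G H \<longleftrightarrow>
     (\<exists>K. subgroup K G \<and> finite (rcosets\<^bsub>G\<^esub> K) \<and> G\<lparr>carrier := K\<rparr> \<cong> H)"

definition sym_gen_set :: "('a, 'm) monoid_scheme \<Rightarrow> 'a set \<Rightarrow> bool" where
  "sym_gen_set G S \<longleftrightarrow>
     finite S \<and> S \<subseteq> carrier G \<and> (\<forall>s\<in>S. inv\<^bsub>G\<^esub> s \<in> S) \<and> generate G S = carrier G"

definition word_len :: "('a, 'm) monoid_scheme \<Rightarrow> 'a set \<Rightarrow> 'a \<Rightarrow> nat" where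
  "word_len G S x =
     (LEAST n. \<exists>w. set w \<subseteq> S \<and> length w = n \<and> foldr (\<otimes>\<^bsub>G\<^esub>) w \<one>\<^bsub>G\<^esub> = x)"

(* Unlike generate, the identity and inverses are not added. *)
inductive_set semigroup_generate :: "('a, 'm) monoid_scheme \<Rightarrow> 'a set \<Rightarrow> 'a set"
  for G and A where
    incl: "a \<in> A \<Longrightarrow> a \<in> semigroup_generate G A"
  | mult: "\<lbrakk>a \<in> semigroup_generate G A; b \<in> semigroup_generate G A\<rbrakk>
            \<Longrightarrow> a \<otimes>\<^bsub>G\<^esub> b \<in> semigroup_generate G A"

definition symmetric_on :: "('a, 'm) monoid_scheme \<Rightarrow> 'a pmf \<Rightarrow> bool" where
  "symmetric_on G \<mu> \<longleftrightarrow> (\<forall>g\<in>carrier G. pmf \<mu> g = pmf \<mu> (inv\<^bsub>G\<^esub> g))"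

definition nondegenerate :: "('a, 'm) monoid_scheme \<Rightarrow> 'a pmf \<Rightarrow> bool" where
  "nondegenerate G \<mu> \<longleftrightarrow> semigroup_generate G (set_pmf \<mu>) = carrier G"

(* A function on the group is a HOL function of which only the values on the carrier matter.
   The sum over the support is meant for finitely supported measures. *)
definition harmonic :: "('a, 'm) monoid_scheme \<Rightarrow> 'a pmf \<Rightarrow> ('a \<Rightarrow> real) \<Rightarrow> bool" where
  "harmonic G \<mu> f \<longleftrightarrow>
     (\<forall>x\<in>carrier G. f x = (\<Sum>g\<in>set_pmf \<mu>. pmf \<mu> g * f (x \<otimes>\<^bsub>G\<^esub> g)))"

definition pos_harmonic :: "('a, 'm) monoid_scheme \<Rightarrow> 'a pmf \<Rightarrow> ('a \<Rightarrow> real) \<Rightarrow> bool" where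
  "pos_harmonic G \<mu> h \<longleftrightarrow> (\<forall>x\<in>carrier G. 0 < h x) \<and> harmonic G \<mu> h"

definition minimal_harmonic :: "('a, 'm) monoid_scheme \<Rightarrow> 'a pmf \<Rightarrow> ('a \<Rightarrow> real) \<Rightarrow> bool" where
  "minimal_harmonic G \<mu> h \<longleftrightarrow> pos_harmonic G \<mu> h \<and>
     (\<forall>u. pos_harmonic G \<mu> u \<and> (\<forall>x\<in>carrier G. u x \<le> h x) \<longrightarrow>
          (\<exists>c>0. \<forall>x\<in>carrier G. u x = c * h x))"

(* Extensionality makes members of this set equal as soon as they agree on the group. *)
definition normalised_minimal :: "('a, 'm) monoid_scheme \<Rightarrow> 'a pmf \<Rightarrow> ('a \<Rightarrow> real) set" where
  "normalised_minimal G \<mu> =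
     {h \<in> extensional (carrier G). minimal_harmonic G \<mu> h \<and> h \<one>\<^bsub>G\<^esub> = 1}"

definition growth_gauge :: "(nat \<Rightarrow> real) \<Rightarrow> bool" where
  "growth_gauge \<psi> \<longleftrightarrow> mono \<psi> \<and> (\<forall>r. 0 < \<psi> r) \<and>
     (\<forall>c. \<exists>K\<ge>1. \<forall>r. \<psi> (r + c) \<le> K * \<psi> r)"

definition growth_at_most ::
    "('a, 'm) monoid_scheme \<Rightarrow> 'a set \<Rightarrow> (nat \<Rightarrow> real) \<Rightarrow> ('a \<Rightarrow> real) \<Rightarrow> bool" where
  "growth_at_most G S \<psi> f \<longleftrightarrow>
     (\<exists>C>0. \<exists>R. \<forall>x\<in>carrier G. R \<le> word_len G S x \<longrightarrow> \<bar>f x\<bar> \<le> C * \<psi> (word_len G S x))"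

definition growth_at_least ::
    "('a, 'm) monoid_scheme \<Rightarrow> 'a set \<Rightarrow> (nat \<Rightarrow> real) \<Rightarrow> ('a \<Rightarrow> real) \<Rightarrow> bool" where
  "growth_at_least G S \<psi> f \<longleftrightarrow>
     (\<exists>C>0. \<forall>\<^sub>F r in sequentially.
        C * \<psi> r \<le> (SUP x\<in>{x \<in> carrier G. word_len G S x \<le> r}. \<bar>f x\<bar>))"

end

theory Submission
  imports Defs
begin

text \<open>
  The group acts on positive functions by normalised left translation, sending \<open>h\<close> to
  \<open>x \<mapsto> h (y x) / h y\<close>.  This action preserves minimal harmonic functions, and it preserves both
  growth conditions because translating by \<open>y\<close> changes word lengths by a bounded amount, which a growth
  gauge absorbs.  So it suffices that a non-constant positive harmonic function has an infinite orbit.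

  Suppose that the orbit \<open>F\<close> is finite, and let \<open>T\<^sub>g u = u (g \<cdot>) / u g\<close>.  The map \<open>T\<^sub>g\<close> is a permutation of
  \<open>F\<close>, and \<open>T\<^sub>g u\<close> takes the value \<open>1 / u g\<close> at \<open>g\<^sup>-\<^sup>1\<close>.  Hence the sum of \<open>u (g\<^sup>-\<^sup>1)\<close> over
  \<open>u \<in> F\<close> equals the sum of \<open>1 / u g\<close>.  Averaging over \<open>g\<close> and using the symmetry of \<open>\<mu>\<close>, the sum of
  \<open>\<mu> g * u g\<close> over all \<open>u\<close> and \<open>g\<close> equals that of \<open>\<mu> g / u g\<close>.  By harmonicity at the identity both
  equal \<open>card F\<close>, so the non-negative numbers \<open>\<mu> g * (u g + 1 / u g - 2)\<close> add up to zero.  Therefore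
  \<open>u g = 1\<close> for all \<open>u \<in> F\<close> and \<open>g\<close> in the support of \<open>\<mu>\<close>.  This says that \<open>h (y g) = h y\<close> for
  all \<open>y\<close>, and since the support generates the group as a semigroup, \<open>h\<close> is constant.
\<close>

section \<open>Word length\<close>

lemma (in group) foldr_mult_closed:
  "set w \<subseteq> carrier G \<Longrightarrow> foldr (\<otimes>) w \<one> \<in> carrier G"
  by (induction w) auto

lemma (in group) foldr_mult_append:
  "set v \<subseteq> carrier G \<Longrightarrow> set w \<subseteq> carrier G \<Longrightarrow>
     foldr (\<otimes>) (v @ w) \<one> = foldr (\<otimes>) v \<one> \<otimes> foldr (\<otimes>) w \<one>"
proof (induction v)
  case Nil
  then show ?case using foldr_mult_closed by simp
next
  case (Cons a v)
  then show ?case using foldr_mult_closed[of v] foldr_mult_closed[of w] by (simp add: m_assoc)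
qed

lemma (in group) sym_gen_set_word:
  assumes S: "sym_gen_set G S" and x: "x \<in> carrier G"
  shows "\<exists>w. set w \<subseteq> S \<and> foldr (\<otimes>) w \<one> = x"
proof -
  have SG: "S \<subseteq> carrier G" and inv: "\<And>s. s \<in> S \<Longrightarrow> inv s \<in> S"
    using S by (auto simp: sym_gen_set_def)
  have "x \<in> generate G S" using S x by (simp add: sym_gen_set_def)
  then show ?thesis
  proof (induction rule: generate.induct)
    case one
    show ?case by (rule exI[of _ "[]"]) simp
  next
    case (incl s)
    then show ?case using SG by (intro exI[of _ "[s]"]) auto
  next
    case (inv s)
    then show ?case using SG assms(1) by (intro exI[of _ "[inv s]"]) (auto simp: sym_gen_set_def)
  next
    case (eng x y)
    then obtain v w where "set v \<subseteq> S" "foldr (\<otimes>) v \<one> = x" "set w \<subseteq> S" "foldr (\<otimes>) w \<one> = y"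
      by blast
    then show ?case using SG foldr_mult_append[of v w] by (intro exI[of _ "v @ w"]) auto
  qed
qed

lemma (in group) word_len_attained:
  assumes "sym_gen_set G S" and "x \<in> carrier G"
  obtains w where "set w \<subseteq> S" "length w = word_len G S x" "foldr (\<otimes>) w \<one> = x"
proof -
  have "\<exists>n w. set w \<subseteq> S \<and> length w = n \<and> foldr (\<otimes>) w \<one> = x"
    using sym_gen_set_word[OF assms] by blast
  from LeastI_ex[OF this] show ?thesis using that unfolding word_len_def by blast
qed

lemma word_len_le:
  "set w \<subseteq> S \<Longrightarrow> foldr (\<otimes>\<^bsub>G\<^esub>) w \<one>\<^bsub>G\<^esub> = x \<Longrightarrow> word_len G S x \<le> length w"
  unfolding word_len_def by (rule Least_le) blast

lemma (in group) word_len_mult: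
  assumes S: "sym_gen_set G S" and "x \<in> carrier G" "y \<in> carrier G"
  shows "word_len G S (x \<otimes> y) \<le> word_len G S x + word_len G S y"
proof -
  obtain v w where v: "set v \<subseteq> S" "length v = word_len G S x" "foldr (\<otimes>) v \<one> = x"
    and w: "set w \<subseteq> S" "length w = word_len G S y" "foldr (\<otimes>) w \<one> = y"
    using word_len_attained[OF S] assms(2,3) by metis
  have "S \<subseteq> carrier G" using S by (simp add: sym_gen_set_def)
  then have "foldr (\<otimes>) (v @ w) \<one> = x \<otimes> y"
    using v w foldr_mult_append[of v w] by auto
  then show ?thesis using word_len_le[of "v @ w" S G] v w by simp
qed

lemma (in group) word_len_cancel:
  assumes S: "sym_gen_set G S" and "y \<in> carrier G" "x \<in> carrier G"
  shows "word_len G S x \<le> word_len G S (inv y) + word_len G S (y \<otimes> x)"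
  using word_len_mult[OF S, of "inv y" "y \<otimes> x"] assms by (simp add: m_assoc[symmetric])

lemma (in group) finite_ball:
  assumes S: "sym_gen_set G S"
  shows "finite {x \<in> carrier G. word_len G S x \<le> r}"
proof (rule finite_subset)
  show "{x \<in> carrier G. word_len G S x \<le> r} \<subseteq>
      (\<lambda>w. foldr (\<otimes>) w \<one>) ` {w. set w \<subseteq> S \<and> length w \<le> r}"
  proof clarify
    fix x assume x: "x \<in> carrier G" "word_len G S x \<le> r"
    obtain w where "set w \<subseteq> S" "length w = word_len G S x" "foldr (\<otimes>) w \<one> = x"
      using word_len_attained[OF S x(1)] by blast
    then show "x \<in> (\<lambda>w. foldr (\<otimes>) w \<one>) ` {w. set w \<subseteq> S \<and> length w \<le> r}"
      using x(2) by (intro image_eqI[of _ _ w]) auto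
  qed
  show "finite ((\<lambda>w. foldr (\<otimes>) w \<one>) ` {w. set w \<subseteq> S \<and> length w \<le> r})"
    using S by (intro finite_imageI finite_lists_length_le) (simp add: sym_gen_set_def)
qed

lemma (in group) word_len_one: "word_len G S \<one> = 0"
  using word_len_le[of "[]" S G] by simp

section \<open>Normalised translates\<close>

definition translate :: "('a, 'm) monoid_scheme \<Rightarrow> ('a \<Rightarrow> real) \<Rightarrow> 'a \<Rightarrow> 'a \<Rightarrow> real" where
  "translate G h y = (\<lambda>x\<in>carrier G. h (y \<otimes>\<^bsub>G\<^esub> x) / h y)"

lemma (in group) pos_harmonic_scaled_shift:
  assumes h: "pos_harmonic G \<mu> h" and y: "y \<in> carrier G" and c: "c > 0"
    and \<mu>: "set_pmf \<mu> \<subseteq> carrier G"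
    and u: "\<And>x. x \<in> carrier G \<Longrightarrow> u x = c * h (y \<otimes> x)"
  shows "pos_harmonic G \<mu> u"
  unfolding pos_harmonic_def harmonic_def
proof (intro conjI ballI)
  fix x assume x: "x \<in> carrier G"
  show "0 < u x" using h x y c u by (simp add: pos_harmonic_def)
  have "h (y \<otimes> x) = (\<Sum>g\<in>set_pmf \<mu>. pmf \<mu> g * h (y \<otimes> x \<otimes> g))"
    using h x y unfolding pos_harmonic_def harmonic_def by blast
  then have "u x = (\<Sum>g\<in>set_pmf \<mu>. c * (pmf \<mu> g * h (y \<otimes> x \<otimes> g)))"
    using u x by (simp add: sum_distrib_left)
  also have "\<dots> = (\<Sum>g\<in>set_pmf \<mu>. pmf \<mu> g * u (x \<otimes> g))"
  proof (rule sum.cong)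
    fix g assume "g \<in> set_pmf \<mu>"
    then have "g \<in> carrier G" using \<mu> by blast
    then show "c * (pmf \<mu> g * h (y \<otimes> x \<otimes> g)) = pmf \<mu> g * u (x \<otimes> g)"
      using u x y by (simp add: m_assoc)
  qed simp
  finally show "u x = (\<Sum>g\<in>set_pmf \<mu>. pmf \<mu> g * u (x \<otimes> g))" .
qed

lemma (in group) pos_harmonic_translate:
  assumes h: "pos_harmonic G \<mu> h" and y: "y \<in> carrier G" and \<mu>: "set_pmf \<mu> \<subseteq> carrier G"
  shows "pos_harmonic G \<mu> (translate G h y)"
  by (rule pos_harmonic_scaled_shift[OF h y _ \<mu>, of "1 / h y"])
    (use h y in \<open>auto simp: translate_def pos_harmonic_def\<close>)

lemma (in group) translate_one:
  assumes "pos_harmonic G \<mu> h" and "y \<in> carrier G"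
  shows "translate G h y \<one> = 1"
proof -
  have "h y > 0" using assms by (simp add: pos_harmonic_def)
  then show ?thesis using assms(2) by (simp add: translate_def)
qed

lemma (in group) translate_translate:
  assumes "pos_harmonic G \<mu> h" and "y \<in> carrier G" "z \<in> carrier G"
  shows "translate G (translate G h y) z = translate G h (y \<otimes> z)"
proof -
  have "h y > 0" using assms by (simp add: pos_harmonic_def)
  then show ?thesis using assms(2,3) by (auto simp: translate_def m_assoc restrict_def)
qed

text \<open>A competitor below the translate by \<open>y\<close> is carried back to one below \<open>h\<close> by \<open>inv y\<close>.\<close>

lemma (in group) minimal_harmonic_translate:
  assumes h: "minimal_harmonic G \<mu> h" and y: "y \<in> carrier G" and \<mu>: "set_pmf \<mu> \<subseteq> carrier G"
  shows "translate G h y \<in> normalised_minimal G \<mu>"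
proof -
  have ph: "pos_harmonic G \<mu> h" using h by (simp add: minimal_harmonic_def)
  then have hy: "h y > 0" using y by (simp add: pos_harmonic_def)
  have "\<exists>c>0. \<forall>x\<in>carrier G. u x = c * translate G h y x"
    if u: "pos_harmonic G \<mu> u" and le: "\<forall>x\<in>carrier G. u x \<le> translate G h y x" for u
  proof -
    define v where "v = (\<lambda>x. h y * u (inv y \<otimes> x))"
    have "pos_harmonic G \<mu> v"
      by (rule pos_harmonic_scaled_shift[OF u _ hy \<mu>, of "inv y"]) (use y in \<open>auto simp: v_def\<close>)
    moreover have "v x \<le> h x" if x: "x \<in> carrier G" for x
    proof -
      have "u (inv y \<otimes> x) \<le> h x / h y"
        using le[rule_format, of "inv y \<otimes> x"] x y by (simp add: translate_def m_assoc[symmetric])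
      then show ?thesis using hy by (simp add: v_def field_simps)
    qed
    ultimately obtain c where c: "c > 0" "\<forall>x\<in>carrier G. v x = c * h x"
      using h unfolding minimal_harmonic_def by blast
    have "u x = c * translate G h y x" if x: "x \<in> carrier G" for x
    proof -
      have "h y * u x = c * h (y \<otimes> x)"
        using c(2)[rule_format, of "y \<otimes> x"] x y by (simp add: v_def m_assoc[symmetric])
      then show ?thesis using hy x by (simp add: translate_def field_simps)
    qed
    then show ?thesis using c(1) by blast
  qed
  then show ?thesis
    using pos_harmonic_translate[OF ph y \<mu>] translate_one[OF ph y]
    by (auto simp: normalised_minimal_def minimal_harmonic_def translate_def)
qed

section \<open>Growth of translates\<close>

lemma (in group) growth_at_most_translate:
  assumes S: "sym_gen_set G S" and \<psi>: "growth_gauge \<psi>"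
    and h: "pos_harmonic G \<mu> h" and y: "y \<in> carrier G" and gr: "growth_at_most G S \<psi> h"
  shows "growth_at_most G S \<psi> (translate G h y)"
proof -
  let ?l = "word_len G S"
  obtain C R where C: "C > 0" "\<And>x. x \<in> carrier G \<Longrightarrow> R \<le> ?l x \<Longrightarrow> \<bar>h x\<bar> \<le> C * \<psi> (?l x)"
    using gr unfolding growth_at_most_def by blast
  obtain K where K: "K \<ge> 1" "\<And>r. \<psi> (r + ?l y) \<le> K * \<psi> r"
    using \<psi> unfolding growth_gauge_def by blast
  have hy: "h y > 0" using h y by (simp add: pos_harmonic_def)
  have "\<bar>translate G h y x\<bar> \<le> (C * K / h y) * \<psi> (?l x)"
    if x: "x \<in> carrier G" and len: "R + ?l (inv y) \<le> ?l x" for x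
  proof -
    have "R \<le> ?l (y \<otimes> x)" using word_len_cancel[OF S y x] len by simp
    then have "\<bar>h (y \<otimes> x)\<bar> \<le> C * \<psi> (?l (y \<otimes> x))" using C(2) x y by simp
    also have "\<psi> (?l (y \<otimes> x)) \<le> \<psi> (?l x + ?l y)"
      using \<psi> word_len_mult[OF S y x] by (simp add: growth_gauge_def mono_def add.commute)
    also have "\<dots> \<le> K * \<psi> (?l x)" by (rule K)
    finally have "\<bar>h (y \<otimes> x)\<bar> \<le> C * (K * \<psi> (?l x))" using C(1) by simp
    then show ?thesis using hy x by (simp add: translate_def field_simps)
  qed
  moreover have "C * K / h y > 0" using C K hy by simp
  ultimately show ?thesis unfolding growth_at_most_def by blast
qed

text \<open>The ball of radius \<open>r + \<bar>inv y\<bar>\<close> contains the shift by \<open>inv y\<close> of the ball of radius \<open>r\<close>,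
  on which the translate takes the values of \<open>h / h y\<close>.\<close>

lemma (in group) growth_at_least_translate:
  assumes S: "sym_gen_set G S" and \<psi>: "growth_gauge \<psi>"
    and h: "pos_harmonic G \<mu> h" and y: "y \<in> carrier G" and gr: "growth_at_least G S \<psi> h"
  shows "growth_at_least G S \<psi> (translate G h y)"
proof -
  let ?l = "word_len G S"
  let ?B = "\<lambda>r. {x \<in> carrier G. ?l x \<le> r}"
  let ?c = "?l (inv y)"
  let ?u = "translate G h y"
  obtain C N where C: "C > 0" "\<And>r. N \<le> r \<Longrightarrow> C * \<psi> r \<le> (SUP x\<in>?B r. \<bar>h x\<bar>)"
    using gr unfolding growth_at_least_def eventually_sequentially by blast
  obtain K where K: "K \<ge> 1" "\<And>r. \<psi> (r + ?c) \<le> K * \<psi> r"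
    using \<psi> unfolding growth_gauge_def by blast
  have hy: "h y > 0" using h y by (simp add: pos_harmonic_def)
  have "C / (K * h y) * \<psi> s \<le> (SUP x\<in>?B s. \<bar>?u x\<bar>)" if s: "N + ?c \<le> s" for s
  proof -
    define r where "r = s - ?c"
    have r: "s = r + ?c" "N \<le> r" using s by (auto simp: r_def)
    have "C / (K * h y) * \<psi> s \<le> C / (K * h y) * (K * \<psi> r)"
      unfolding r(1) using C K hy by (intro mult_left_mono K(2)) simp
    also have "\<dots> = C * \<psi> r / h y" using K by simp
    also have "\<dots> \<le> (SUP x\<in>?B r. \<bar>h x\<bar>) / h y"
      using C(2)[OF r(2)] hy by (simp add: divide_right_mono)
    also have "\<dots> \<le> (SUP x\<in>?B s. \<bar>?u x\<bar>)"
    proof -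
      have "(SUP x\<in>?B r. \<bar>h x\<bar>) \<le> h y * (SUP x\<in>?B s. \<bar>?u x\<bar>)"
      proof (rule cSUP_least)
        show "?B r \<noteq> {}" using word_len_one[of S] by force
        fix z assume z: "z \<in> ?B r"
        then have x: "inv y \<otimes> z \<in> ?B s"
          using word_len_mult[OF S, of "inv y" z] y r(1) by simp
        have "\<bar>?u (inv y \<otimes> z)\<bar> \<le> (SUP x\<in>?B s. \<bar>?u x\<bar>)"
          by (rule cSUP_upper[OF x]) (intro bdd_above_finite finite_imageI finite_ball[OF S])
        moreover have "\<bar>?u (inv y \<otimes> z)\<bar> = \<bar>h z\<bar> / h y"
          using z y hy by (simp add: translate_def m_assoc[symmetric])
        ultimately show "\<bar>h z\<bar> \<le> h y * (SUP x\<in>?B s. \<bar>?u x\<bar>)"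
          using hy by (simp add: field_simps)
      qed
      then show ?thesis using hy by (simp add: field_simps)
    qed
    finally show ?thesis .
  qed
  moreover have "C / (K * h y) > 0" using C K hy by simp
  ultimately show ?thesis unfolding growth_at_least_def eventually_sequentially by blast
qed

section \<open>A finite orbit forces constancy\<close>

lemma (in group) const_if_semigroup_invariant:
  assumes gen: "semigroup_generate G A = carrier G"
    and inv: "\<And>y g. y \<in> carrier G \<Longrightarrow> g \<in> A \<Longrightarrow> h (y \<otimes> g) = h y"
  shows "h constant_on carrier G"
proof -
  have "\<forall>y\<in>carrier G. h (y \<otimes> a) = h y" if "a \<in> semigroup_generate G A" for a
    using that
  proof (induction rule: semigroup_generate.induct)
    case (incl a)
    then show ?case using inv by blast
  next
    case (mult a b)
    then have "a \<in> carrier G" "b \<in> carrier G" using gen by auto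
    then show ?case using mult.IH by (simp add: m_assoc[symmetric])
  qed
  then have "h a = h \<one>" if "a \<in> carrier G" for a
    using that gen by (metis l_one one_closed)
  then show ?thesis unfolding constant_on_def by blast
qed

text \<open>Translation by \<open>g\<close> permutes the orbit, its inverse being translation by \<open>inv g\<close>, and it
  inverts the ratio along the edge from \<open>\<one>\<close> to \<open>g\<close> because that edge is then read backwards.\<close>

lemma (in group) sum_orbit_inverse:
  fixes h defines "F \<equiv> translate G h ` carrier G"
  assumes h: "pos_harmonic G \<mu> h" and g: "g \<in> carrier G"
  shows "(\<Sum>u\<in>F. 1 / u g) = (\<Sum>u\<in>F. u (inv g))"
proof (rule sum.reindex_bij_witness[where i = "\<lambda>u. translate G u (inv g)" and j = "\<lambda>u. translate G u g"])
  fix u assume "u \<in> F"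
  then obtain y where y: "y \<in> carrier G" "u = translate G h y" by (auto simp: F_def)
  have 1: "translate G u g = translate G h (y \<otimes> g)"
    and 2: "translate G u (inv g) = translate G h (y \<otimes> inv g)"
    using translate_translate[OF h] y g by auto
  show "translate G u g \<in> F" "translate G u (inv g) \<in> F"
    unfolding 1 2 using y g by (auto simp: F_def)
  show "translate G (translate G u g) (inv g) = u" "translate G (translate G u (inv g)) g = u"
    unfolding 1 2 using translate_translate[OF h] y g by (auto simp: m_assoc)
  show "translate G u g (inv g) = 1 / u g"
    using translate_one[OF h y(1)] y g by (simp add: translate_def)
qed

lemma (in group) finite_orbit_imp_constant:
  assumes h: "pos_harmonic G \<mu> h" and fin: "finite (translate G h ` carrier G)"
    and \<mu>: "set_pmf \<mu> \<subseteq> carrier G" "finite (set_pmf \<mu>)"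
    and sym: "symmetric_on G \<mu>" and nd: "nondegenerate G \<mu>"
  shows "h constant_on carrier G"
proof -
  define F where "F = translate G h ` carrier G"
  let ?M = "set_pmf \<mu>"
  have ph: "pos_harmonic G \<mu> u" and one: "u \<one> = 1" if "u \<in> F" for u
    using that pos_harmonic_translate[OF h _ \<mu>(1)] translate_one[OF h] by (auto simp: F_def)
  have pos: "u g > 0" if "u \<in> F" "g \<in> ?M" for u g
    using ph[OF that(1)] that(2) \<mu>(1) by (auto simp: pos_harmonic_def)
  have inM: "inv g \<in> ?M \<and> pmf \<mu> (inv g) = pmf \<mu> g" if "g \<in> ?M" for g
  proof -
    have "pmf \<mu> g = pmf \<mu> (inv g)" using that sym \<mu>(1) unfolding symmetric_on_def by blast
    then show ?thesis using that by (simp add: set_pmf_iff)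
  qed
  have mean: "(\<Sum>g\<in>?M. pmf \<mu> g * u g) = 1" if u: "u \<in> F" for u
  proof -
    have "u \<one> = (\<Sum>g\<in>?M. pmf \<mu> g * u (\<one> \<otimes> g))"
      using ph[OF u] unfolding pos_harmonic_def harmonic_def by blast
    also have "\<dots> = (\<Sum>g\<in>?M. pmf \<mu> g * u g)"
      using \<mu>(1) by (intro sum.cong) auto
    finally show ?thesis using one[OF u] by simp
  qed
  have mass: "(\<Sum>g\<in>?M. pmf \<mu> g) = 1" using \<mu>(2) by (simp add: sum_pmf_eq_1)
  have reversed: "(\<Sum>u\<in>F. \<Sum>g\<in>?M. pmf \<mu> g * (1 / u g)) = card F"
  proof -
    have "(\<Sum>u\<in>F. \<Sum>g\<in>?M. pmf \<mu> g * (1 / u g)) = (\<Sum>g\<in>?M. pmf \<mu> g * (\<Sum>u\<in>F. 1 / u g))"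
      by (subst sum.swap) (simp add: sum_distrib_left)
    also have "\<dots> = (\<Sum>g\<in>?M. pmf \<mu> (inv g) * (\<Sum>u\<in>F. u (inv g)))"
      using sum_orbit_inverse[OF h] \<mu>(1) inM by (intro sum.cong) (auto simp: F_def subset_iff)
    also have "\<dots> = (\<Sum>g\<in>?M. pmf \<mu> g * (\<Sum>u\<in>F. u g))"
      by (rule sum.reindex_bij_witness[where i = "\<lambda>g. inv g" and j = "\<lambda>g. inv g"])
        (use inM \<mu>(1) in \<open>auto simp: subset_iff\<close>)
    also have "\<dots> = (\<Sum>u\<in>F. \<Sum>g\<in>?M. pmf \<mu> g * u g)"
      by (subst sum.swap) (simp add: sum_distrib_left)
    finally show ?thesis using mean by simp
  qed
  have "(\<Sum>u\<in>F. \<Sum>g\<in>?M. pmf \<mu> g * (u g + 1 / u g - 2)) =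
      (\<Sum>u\<in>F. (\<Sum>g\<in>?M. pmf \<mu> g * u g) + (\<Sum>g\<in>?M. pmf \<mu> g * (1 / u g)) - 2 * (\<Sum>g\<in>?M. pmf \<mu> g))"
    by (simp add: algebra_simps sum.distrib sum_subtractf sum_distrib_left)
  also have "\<dots> = 0"
    using mean mass reversed by (simp add: sum.distrib sum_subtractf)
  finally have zero: "(\<Sum>u\<in>F. \<Sum>g\<in>?M. pmf \<mu> g * (u g + 1 / u g - 2)) = 0" .
  have amgm: "u g + 1 / u g - 2 = (u g - 1)\<^sup>2 / u g" if "u \<in> F" "g \<in> ?M" for u g
    using pos[OF that] by (simp add: field_simps power2_eq_square)
  have nonneg: "0 \<le> pmf \<mu> g * (u g + 1 / u g - 2)" if "u \<in> F" "g \<in> ?M" for u g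
    unfolding amgm[OF that] using pos[OF that] by simp
  have val: "u g = 1" if "u \<in> F" "g \<in> ?M" for u g
  proof -
    have "(\<Sum>g\<in>?M. pmf \<mu> g * (u g + 1 / u g - 2)) = 0"
      using zero fin that(1) nonneg unfolding F_def[symmetric]
      by (subst (asm) sum_nonneg_eq_0_iff) (auto intro: sum_nonneg)
    then have "pmf \<mu> g * (u g + 1 / u g - 2) = 0"
      using \<mu>(2) that nonneg by (subst (asm) sum_nonneg_eq_0_iff) auto
    then show ?thesis
      unfolding amgm[OF that] using pos[OF that] that(2) by (auto simp: set_pmf_iff)
  qed
  have "h (y \<otimes> g) = h y" if y: "y \<in> carrier G" and g: "g \<in> ?M" for y g
  proof -
    have "translate G h y g = 1" using val y g by (simp add: F_def)
    moreover have "h y > 0" using h y by (simp add: pos_harmonic_def)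
    ultimately show ?thesis using g \<mu>(1) by (auto simp: translate_def subset_iff)
  qed
  then show ?thesis
    using const_if_semigroup_invariant[of ?M h] nd by (simp add: nondegenerate_def)
qed

section \<open>Infinitely many minimal harmonic functions\<close>

lemma (in group) infinite_minimal_of_translation_invariant:
  assumes \<mu>: "set_pmf \<mu> \<subseteq> carrier G" "finite (set_pmf \<mu>)" "symmetric_on G \<mu>" "nondegenerate G \<mu>"
    and h: "minimal_harmonic G \<mu> h" and nc: "\<not> h constant_on carrier G"
    and P: "\<And>y. y \<in> carrier G \<Longrightarrow> P (translate G h y)"
  shows "infinite {u \<in> normalised_minimal G \<mu>. P u}"
proof
  assume "finite {u \<in> normalised_minimal G \<mu>. P u}"
  moreover have "translate G h ` carrier G \<subseteq> {u \<in> normalised_minimal G \<mu>. P u}"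
    using minimal_harmonic_translate[OF h _ \<mu>(1)] P by blast
  ultimately have "finite (translate G h ` carrier G)" by (rule rev_finite_subset)
  then show False
    using finite_orbit_imp_constant \<mu> h nc unfolding minimal_harmonic_def by blast
qed

theorem theoremF:
  fixes G :: "('a, 'm) monoid_scheme" and S :: "'a set"
    and \<mu> :: "'a pmf" and \<psi> :: "nat \<Rightarrow> real"
  assumes "group G" and "infinite (carrier G)" and "sym_gen_set G S"
    and "\<not> virtually G integer_group"
    and "\<not> virtually G (integer_group \<times>\<times> integer_group)"
    and "set_pmf \<mu> \<subseteq> carrier G" and "finite (set_pmf \<mu>)"
    and "symmetric_on G \<mu>" and "nondegenerate G \<mu>"
    and "growth_gauge \<psi>"
  shows "((\<exists>h. minimal_harmonic G \<mu> h \<and> \<not> h constant_on carrier G \<and> growth_at_least G S \<psi> h) \<longrightarrow>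
            infinite {h \<in> normalised_minimal G \<mu>. growth_at_least G S \<psi> h}) \<and>
         ((\<exists>h. minimal_harmonic G \<mu> h \<and> \<not> h constant_on carrier G \<and> growth_at_most G S \<psi> h) \<longrightarrow>
            infinite {h \<in> normalised_minimal G \<mu>. growth_at_most G S \<psi> h})"
proof -
  interpret group G by fact
  have ph: "pos_harmonic G \<mu> h" if "minimal_harmonic G \<mu> h" for h
    using that by (simp add: minimal_harmonic_def)
  show ?thesis
  proof (intro conjI impI; elim exE conjE)
    fix h
    assume h: "minimal_harmonic G \<mu> h" "\<not> h constant_on carrier G" "growth_at_least G S \<psi> h"
    show "infinite {h \<in> normalised_minimal G \<mu>. growth_at_least G S \<psi> h}"
      by (rule infinite_minimal_of_translation_invariant[OF assms(6-9) h(1,2)],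
          rule growth_at_least_translate[OF assms(3,10) ph[OF h(1)] _ h(3)])
  next
    fix h
    assume h: "minimal_harmonic G \<mu> h" "\<not> h constant_on carrier G" "growth_at_most G S \<psi> h"
    show "infinite {h \<in> normalised_minimal G \<mu>. growth_at_most G S \<psi> h}"
      by (rule infinite_minimal_of_translation_invariant[OF assms(6-9) h(1,2)],
          rule growth_at_most_translate[OF assms(3,10) ph[OF h(1)] _ h(3)])
  qed
qed

end
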